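(* Let $(\mathcal{A},\cdot)$ and $(\mathcal{B},\circ)$ be two center-symmetric algebras. Suppose that $(l_{\mathcal{A}},r_{\mathcal{A}},\mathcal{B})$ is a bimodule of $\mathcal{A}$ and $(l_{\mathcal{B}},r_{\mathcal{B}},\mathcal{A})$ is a bimodule of $\mathcal{B}$, satisfying, for all $x,y\in\mathcal{A}$ and $a,b\in\mathcal{B}$: $$-r_{\mathcal{A}}(x)(a\circ b)+r_{\mathcal{A}}(l_{\mathcal{B}}(b)x)a+a\circ(r_{\mathcal{A}}(x)b)+l_{\mathcal{A}}(r_{\mathcal{B}}(b)x)a+(l_{\mathcal{A}}(x)b)\circ a-l_{\mathcal{A}}(x)(b\circ a)=0,$$ $$-r_{\mathcal{B}}(a)(x\cdot y)+r_{\mathcal{B}}(l_{\mathcal{A}}(y)a)x+x\cdot(r_{\mathcal{B}}(a)y)+l_{\mathcal{B}}(r_{\mathcal{A}}(y)a)x+(l_{\mathcal{B}}(a)y)\cdot x-l_{\mathcal{B}}(a)(y\cdot x)=0,$$ $$a\circ(l_{\mathcal{A}}(x)b)+(r_{\mathcal{A}}(x)b)\circ a-(r_{\mathcal{A}}(x)a)\circ b-l_{\mathcal{A}}(l_{\mathcal{B}}(a)x)b+r_{\mathcal{A}}(r_{\mathcal{B}}(b)x)a+l_{\mathcal{A}}(l_{\mathcal{B}}(b)x)a-b\circ(l_{\mathcal{A}}(x)a)-r_{\mathcal{A}}(r_{\mathcal{B}}(a)x)b=0,$$ $$x\cdot(l_{\mathcal{B}}(a)y)+(r_{\mathcal{B}}(a)y)\cdot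 x-(r_{\mathcal{B}}(a)x)\cdot y-l_{\mathcal{B}}(l_{\mathcal{A}}(x)a)y+r_{\mathcal{B}}(r_{\mathcal{A}}(y)a)x+l_{\mathcal{B}}(l_{\mathcal{A}}(y)a)x-y\cdot(l_{\mathcal{B}}(a)x)-r_{\mathcal{B}}(r_{\mathcal{A}}(x)a)y=0.$$ Then the product $$(x+a)\ast(y+b)=(x\cdot y+l_{\mathcal{B}}(a)y+r_{\mathcal{B}}(b)x)+(a\circ b+l_{\mathcal{A}}(x)b+r_{\mathcal{A}}(y)a)$$ defines a center-symmetric algebra structure on $\mathcal{A}\oplus\mathcal{B}$.
   Context: Throughout, algebras are finite-dimensional over a field $\mathbb{K}$ of characteristic zero. A vector space with a bilinear product is a center-symmetric algebra if its associator $(x,y,z):=(xy)z-x(yz)$ satisfies $(x,y,z)=(z,y,x)$ for all $x,y,z$. For a center-symmetric algebra $\mathcal{A}$, a vector space $V$ and linear maps $l,r:\mathcal{A}\to\mathfrak{gl}(V)$ (with $l_x=l(x)$, $r_x=r(x)$), the triple $(l,r,V)$ is called a bimodule of $\mathcal{A}$ if for all $x,y\in\mathcal{A}$: $[l_x,r_y]=[l_y,r_x]$ and $l_{xy}-l_xl_y=r_xr_y-r_{yx}$ (where the bracket is the commutator of operators). In particular $l_{\mathcal{A}},r_{\mathcal{A}}:\mathcal{A}\to\mathfrak{gl}(\mathcal{B})$ and $l_{\mathcal{B}},r_{\mathcal{B}}:\mathcal{B}\to\mathfrak{gl}(\mathcal{A})$. *)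

theory Defs
  imports "HOL-Analysis.Product_Vector"
begin

definition bilinear_map ::
  "('k::field \<Rightarrow> 'a::ab_group_add \<Rightarrow> 'a) \<Rightarrow> ('k \<Rightarrow> 'b::ab_group_add \<Rightarrow> 'b) \<Rightarrow>
   ('k \<Rightarrow> 'c::ab_group_add \<Rightarrow> 'c) \<Rightarrow> ('a \<Rightarrow> 'b \<Rightarrow> 'c) \<Rightarrow> bool"
  where "bilinear_map s1 s2 s3 f \<longleftrightarrow>
    (\<forall>x. Vector_Spaces.linear s2 s3 (f x)) \<and> (\<forall>y. Vector_Spaces.linear s1 s3 (\<lambda>x. f x y))"

definition associator :: "('a::ab_group_add \<Rightarrow> 'a \<Rightarrow> 'a) \<Rightarrow> 'a \<Rightarrow> 'a \<Rightarrow> 'a \<Rightarrow> 'a"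
  where "associator m x y z = m (m x y) z - m x (m y z)"

definition commutator :: "('v::ab_group_add \<Rightarrow> 'v) \<Rightarrow> ('v \<Rightarrow> 'v) \<Rightarrow> 'v \<Rightarrow> 'v"
  where "commutator f g = (\<lambda>v. f (g v) - g (f v))"

locale center_symmetric_algebra = vector_space scale
  for scale :: "'k::field_char_0 \<Rightarrow> 'a::ab_group_add \<Rightarrow> 'a" +
  fixes mult :: "'a \<Rightarrow> 'a \<Rightarrow> 'a"
  assumes finite_dimensional: "\<exists>S. finite S \<and> span S = UNIV"
    and bilinear_mult: "bilinear_map scale scale scale mult"
    and center_symmetric: "associator mult x y z = associator mult z y x"

(* A linear map from the algebra to gl(V) is encoded in uncurried form, as a map
   that is linear in the algebra element and in the vector it acts on. *)
locale center_symmetric_bimodule =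
  A: center_symmetric_algebra scaleA mult + V: vector_space scaleV
  for scaleA :: "'k::field_char_0 \<Rightarrow> 'a::ab_group_add \<Rightarrow> 'a"
    and mult :: "'a \<Rightarrow> 'a \<Rightarrow> 'a"
    and scaleV :: "'k \<Rightarrow> 'v::ab_group_add \<Rightarrow> 'v" +
  fixes l r :: "'a \<Rightarrow> 'v \<Rightarrow> 'v"
  assumes linear_l: "bilinear_map scaleA scaleV scaleV l"
    and linear_r: "bilinear_map scaleA scaleV scaleV r"
    and commutator_l_r: "commutator (l x) (r y) = commutator (l y) (r x)"
    and l_mult: "l (mult x y) v - l x (l y v) = r x (r y v) - r (mult y x) v"

(* The direct sum of A and B is the product type; the pair (x, a) stands for x + a. *)
definition direct_sum_product ::
  "('a::ab_group_add \<Rightarrow> 'a \<Rightarrow> 'a) \<Rightarrow> ('b::ab_group_add \<Rightarrow> 'b \<Rightarrow> 'b) \<Rightarrow>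
   ('a \<Rightarrow> 'b \<Rightarrow> 'b) \<Rightarrow> ('a \<Rightarrow> 'b \<Rightarrow> 'b) \<Rightarrow> ('b \<Rightarrow> 'a \<Rightarrow> 'a) \<Rightarrow> ('b \<Rightarrow> 'a \<Rightarrow> 'a) \<Rightarrow>
   'a \<times> 'b \<Rightarrow> 'a \<times> 'b \<Rightarrow> 'a \<times> 'b"
  where "direct_sum_product multA multB lA rA lB rB = (\<lambda>(x, a) (y, b).
    (multA x y + lB a y + rB b x, multB a b + lA x b + rA y a))"

end

(* Expanding the associator of x + a, y + b, z + c by trilinearity, the part with values in A
   splits according to which arguments come from B: (x, y, z) is handled by the center-symmetry
   of A, (a, b, z) against (x, b, c) and (a, y, c) by the two bimodule axioms of (l_B, r_B, A),
   and (a, y, z) against (x, y, c) and (x, b, z) by the two compatibility conditions with values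
   in A.  The part with values in B follows by exchanging the roles of A and B. *)
theory Submission
  imports Defs
begin

text \<open>The predicate \<open>linear\<close> includes the vector space axioms of both spaces.
  Assuming them turns bilinearity into plain identities, the form in which it is checked for the new
  product.\<close>

lemma bilinear_map_iff:
  assumes "vector_space s1" "vector_space s2" "vector_space s3"
  shows "bilinear_map s1 s2 s3 f \<longleftrightarrow>
    (\<forall>x y y'. f x (y + y') = f x y + f x y') \<and> (\<forall>x x' y. f (x + x') y = f x y + f x' y) \<and>
    (\<forall>c x y. f x (s2 c y) = s3 c (f x y)) \<and> (\<forall>c x y. f (s1 c x) y = s3 c (f x y))"
  using assms unfolding bilinear_map_def Vector_Spaces.linear_iff by auto

lemma bilinear_mapD:
  assumes "bilinear_map s1 s2 s3 f"
  shows "f x (y + y') = f x y + f x y'" "f (x + x') y = f x y + f x' y"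
    "f x (s2 c y) = s3 c (f x y)" "f (s1 c x) y = s3 c (f x y)"
  using assms unfolding bilinear_map_def Vector_Spaces.linear_iff by auto

lemma direct_sum_product_swap:
  "prod.swap (direct_sum_product mA mB lA rA lB rB u v) =
     direct_sum_product mB mA lB rB lA rA (prod.swap u) (prod.swap v)"
  by (cases u; cases v) (simp add: direct_sum_product_def)

text \<open>The formula for the product keeps its shape when the two summands trade places. This
  lets a result on the first component be carried over to the second.\<close>

lemma associator_direct_sum_product_swap:
  fixes mA :: "'a::ab_group_add \<Rightarrow> 'a \<Rightarrow> 'a" and mB :: "'b::ab_group_add \<Rightarrow> 'b \<Rightarrow> 'b"
  shows "prod.swap (associator (direct_sum_product mA mB lA rA lB rB) u v w) =
     associator (direct_sum_product mB mA lB rB lA rA) (prod.swap u) (prod.swap v) (prod.swap w)"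
proof -
  have "prod.swap (p - q) = prod.swap p - prod.swap q" for p q :: "'a \<times> 'b"
    by (simp add: prod_eq_iff)
  then show ?thesis
    by (simp add: associator_def direct_sum_product_swap)
qed

lemma fst_associator_direct_sum_product:
  fixes mA :: "'a::ab_group_add \<Rightarrow> 'a \<Rightarrow> 'a" (infixl "\<cdot>" 70)
    and mB :: "'b::ab_group_add \<Rightarrow> 'b \<Rightarrow> 'b" (infixl "\<odot>" 70)
  assumes A: "center_symmetric_algebra sA mA"
    and bimodule: "center_symmetric_bimodule sB mB sA lB rB"
    and compat1: "\<And>x y a. - rB a (x \<cdot> y) + rB (lA y a) x + x \<cdot> rB a y
           + lB (rA y a) x + lB a y \<cdot> x - lB a (y \<cdot> x) = 0"
    and compat2: "\<And>x y a. x \<cdot> lB a y + rB a y \<cdot> x - rB a x \<cdot> y - lB (lA x a) y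
           + rB (rA y a) x + lB (lA y a) x - y \<cdot> lB a x - rB (rA x a) y = 0"
  shows "fst (associator (direct_sum_product mA mB lA rA lB rB) u v w) =
    fst (associator (direct_sum_product mA mB lA rA lB rB) w v u)"
proof -
  interpret A: center_symmetric_algebra sA mA by fact
  interpret M: center_symmetric_bimodule sB mB sA lB rB by fact
  note additive = bilinear_mapD(1,2)[OF A.bilinear_mult] bilinear_mapD(1,2)[OF M.linear_l]
    bilinear_mapD(1,2)[OF M.linear_r]
  \<comment> \<open>Each letter is the \<open>A\<close>-part of an associator with a fixed pattern
    of arguments from \<open>B\<close>: first (\<open>f\<close>), third (\<open>f'\<close>), middle
    (\<open>g\<close>), first two (\<open>h\<close>), last two (\<open>h'\<close>), outer two
    (\<open>k\<close>). Three arguments from \<open>B\<close> contribute nothing, since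
    \<open>B\<close> is closed under the product.\<close>
  define f where "f a y z = lB a y \<cdot> z + lB (rA y a) z - lB a (y \<cdot> z)" for a y z
  define f' where "f' x y c = rB c (x \<cdot> y) - x \<cdot> rB c y - rB (lA y c) x" for x y c
  define g where "g x b z = rB b x \<cdot> z + lB (lA x b) z - x \<cdot> lB b z - rB (rA z b) x" for x b z
  define h where "h a b z = lB (a \<odot> b) z - lB a (lB b z)" for a b z
  define h' where "h' x b c = rB c (rB b x) - rB (b \<odot> c) x" for x b c
  define k where "k a y c = rB c (lB a y) - lB a (rB c y)" for a y c
  have expand: "fst (associator (direct_sum_product mA mB lA rA lB rB) (x, a) (y, b) (z, c)) =
      associator mA x y z + f a y z + f' x y c + g x b z + h a b z + h' x b c + k a y c"
    for x y z a b c
    unfolding associator_def direct_sum_product_def f_def f'_def g_def h_def h'_def k_def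
    by (simp add: additive)
  \<comment> \<open>Reversing the arguments exchanges \<open>f\<close> with \<open>f'\<close> and
    \<open>h\<close> with \<open>h'\<close>, while it should fix \<open>g\<close> and
    \<open>k\<close>. Here \<open>compat1\<close>, with \<open>z\<close> in the place of
    \<open>x\<close>, reads \<open>f a y z - f' z y a = 0\<close>.\<close>
  have f: "f a y z = f' z y a" for a y z
    using compat1[of a z y] unfolding f_def f'_def by (simp add: algebra_simps)
  \<comment> \<open>The left side of \<open>compat2\<close> is
    \<open>g z b x - g x b z\<close>.\<close>
  have g: "g x b z = g z b x" for x b z
    using compat2[of x b z] unfolding g_def by (simp add: algebra_simps)
  have h: "h a b z = h' z b a" for a b z
    using M.l_mult[of a b z] unfolding h_def h'_def by simp
  \<comment> \<open>\<open>k a y c\<close> is the negative of the commutator of \<open>lB a\<close>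
    and \<open>rB c\<close>, evaluated at \<open>y\<close>.\<close>
  have k: "k a y c = k c y a" for a y c
    using fun_cong[OF M.commutator_l_r[of a c], of y]
    unfolding k_def commutator_def by (simp add: algebra_simps)
  obtain x a y b z c where "u = (x, a)" "v = (y, b)" "w = (z, c)"
    by (metis surj_pair)
  then show ?thesis
    using g[of x b z] k[of a y c] A.center_symmetric[of x y z]
    by (simp add: expand f h algebra_simps)
qed

text \<open>Finite spanning sets of the factors, placed on the two coordinate axes, span the axes,
  and the sum of the axes is the whole product.\<close>

lemma (in vector_space_prod) finite_spanning_set_prod:
  assumes "\<exists>S. finite S \<and> vs1.span S = UNIV" and "\<exists>T. finite T \<and> vs2.span T = UNIV"
  shows "\<exists>U. finite U \<and> p.span U = UNIV"
proof -
  obtain S T where "finite S" "vs1.span S = UNIV" "finite T" "vs2.span T = UNIV"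
    using assms by blast
  moreover from this have "p.span (S \<times> {0} \<union> {0} \<times> T) = UNIV"
    by (force simp: p.span_Un span_Times_sing1 span_Times_sing2)
  ultimately show ?thesis
    by (intro exI[of _ "S \<times> {0} \<union> {0} \<times> T"]) simp
qed

theorem theorem3p6:
  fixes sA :: "'k::field_char_0 \<Rightarrow> 'a::ab_group_add \<Rightarrow> 'a"
    and sB :: "'k \<Rightarrow> 'b::ab_group_add \<Rightarrow> 'b"
    and mA :: "'a \<Rightarrow> 'a \<Rightarrow> 'a" (infixl "\<cdot>" 70)
    and mB :: "'b \<Rightarrow> 'b \<Rightarrow> 'b" (infixl "\<odot>" 70)
    and lA rA :: "'a \<Rightarrow> 'b \<Rightarrow> 'b"
    and lB rB :: "'b \<Rightarrow> 'a \<Rightarrow> 'a"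
  assumes "center_symmetric_algebra sA mA"
    and "center_symmetric_algebra sB mB"
    and "center_symmetric_bimodule sA mA sB lA rA"
    and "center_symmetric_bimodule sB mB sA lB rB"
    and "\<And>x a b. - rA x (a \<odot> b) + rA (lB b x) a + a \<odot> rA x b
           + lA (rB b x) a + lA x b \<odot> a - lA x (b \<odot> a) = 0"
    and "\<And>x y a. - rB a (x \<cdot> y) + rB (lA y a) x + x \<cdot> rB a y
           + lB (rA y a) x + lB a y \<cdot> x - lB a (y \<cdot> x) = 0"
    and "\<And>x a b. a \<odot> lA x b + rA x b \<odot> a - rA x a \<odot> b - lA (lB a x) b
           + rA (rB b x) a + lA (lB b x) a - b \<odot> lA x a - rA (rB a x) b = 0"
    and "\<And>x y a. x \<cdot> lB a y + rB a y \<cdot> x - rB a x \<cdot> y - lB (lA x a) y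
           + rB (rA y a) x + lB (lA y a) x - y \<cdot> lB a x - rB (rA x a) y = 0"
  shows "center_symmetric_algebra (module_prod.scale sA sB)
           (direct_sum_product mA mB lA rA lB rB)"
proof -
  interpret A: center_symmetric_algebra sA mA by fact
  interpret B: center_symmetric_algebra sB mB by fact
  interpret MA: center_symmetric_bimodule sA mA sB lA rA by fact
  interpret MB: center_symmetric_bimodule sB mB sA lB rB by fact
  interpret vector_space_prod sA sB ..
  note bilinear = A.bilinear_mult B.bilinear_mult MA.linear_l MA.linear_r MB.linear_l MB.linear_r
  let ?m = "direct_sum_product mA mB lA rA lB rB"
  show ?thesis
  proof
    show "\<exists>S. finite S \<and> p.span S = UNIV"
      by (rule finite_spanning_set_prod[OF A.finite_dimensional B.finite_dimensional])
    show "bilinear_map scale scale scale ?m"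
      unfolding bilinear_map_iff[OF p.vector_space_axioms p.vector_space_axioms p.vector_space_axioms]
      by (auto simp: direct_sum_product_def scale_prod A.scale_right_distrib B.scale_right_distrib
          bilinear[THEN bilinear_mapD(1)] bilinear[THEN bilinear_mapD(2)]
          bilinear[THEN bilinear_mapD(3)] bilinear[THEN bilinear_mapD(4)])
    show "associator ?m u v w = associator ?m w v u" for u v w
    proof (rule prod_eqI)
      show "fst (associator ?m u v w) = fst (associator ?m w v u)"
        by (rule fst_associator_direct_sum_product[OF assms(1,4,6,8)])
      \<comment> \<open>After the swap, the \<open>B\<close>-component is the first component for
        the product with \<open>A\<close> and \<open>B\<close> exchanged, so the bimodule over
        \<open>A\<close> and the two conditions with values in \<open>B\<close> now apply.\<close>
      have "fst (prod.swap (associator ?m u v w)) = fst (prod.swap (associator ?m w v u))"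
        unfolding associator_direct_sum_product_swap
        by (rule fst_associator_direct_sum_product[OF assms(2,3,5,7)])
      then show "snd (associator ?m u v w) = snd (associator ?m w v u)"
        by simp
    qed
  qed
qed

end
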